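(* Let $\mathcal{G}$ be the set of links of a directed unweighted network without self-links on the finite node set $N$. For any nodes $i,j\in N$, the following identities of formal power series in $x$ hold. (i) For any set of nodes $A\subseteq N$, $$m_{ij}=m_{ij}^{\lnot A}+m_{ij}^{A},\qquad m_{ij}^{A}=\sum_{l\in A}\big(m_{il}^{\lnot A}-\mathbf{1}_{l=i}\big)\big(m_{lj}-\mathbf{1}_{l=j}\big).$$ (ii) For any set of links $\mathcal{L}\subseteq\mathcal{G}$, $$m_{ij}=m_{ij}^{\lnot\mathcal{L}}+m_{ij}^{\mathcal{L}},\qquad m_{ij}^{\mathcal{L}}=\sum_{(l,k)\in\mathcal{L}}m_{il}^{\lnot\mathcal{L}}\cdot m_{kj}\cdot x.$$
   Context: $N=\{1,\dots,n\}$; the network has adjacency matrix $\mathbf{G}=(g_{ij})$ with $g_{ij}\in\{0,1\}$, $g_{ii}=0$, and $\mathcal{G}=\{(i,j):g_{ij}=1\}$. A walk is a node sequence $w=(i_0,\dots,i_K)$, $K\ge 0$, with $(i_k,i_{k+1})\in\mathcal{G}$ for $k=0,\dots,K-1$; its length is $K$ (length-zero walks $(i)$ are allowed). $\mathcal{W}_{ij}$ is the set of walks with $i_0=i$ and $i_K=j$. For $A\subseteq N$: $\mathcal{W}_{ij}(A)$ is the set of $w=(i_0,\dots,i_K)\in\mathcal{W}_{ij}$ with $i_k\in A$ for some $k\in\{1,\dots,K-1\}$; $\mathcal{W}_{ij}(\lnot A)$ is the set of $w\in\mathcal{W}_{ij}$ with $i_k\notin A$ for all $k\in\{1,\dots,K-1\}$.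 For $\mathcal{L}\subseteq\mathcal{G}$: $\mathcal{W}_{ij}(\mathcal{L})$ is the set of $w\in\mathcal{W}_{ij}$ with $(i_k,i_{k+1})\in\mathcal{L}$ for some $k\in\{0,\dots,K-1\}$; $\mathcal{W}_{ij}(\lnot\mathcal{L})$ is the set of $w\in\mathcal{W}_{ij}$ with $(i_k,i_{k+1})\notin\mathcal{L}$ for all $k\in\{0,\dots,K-1\}$. For a set of walks $\mathcal{W}'$, its generating function is the formal power series $M[[\mathcal{W}';x]]=\sum_{t\ge0}c_t x^t$, where $c_t$ is the number of walks of length $t$ in $\mathcal{W}'$. Notation: $m_{ij}=M[[\mathcal{W}_{ij};x]]$, $m_{ij}^{A}=M[[\mathcal{W}_{ij}(A);x]]$, $m_{ij}^{\lnot A}=M[[\mathcal{W}_{ij}(\lnot A);x]]$, $m_{ij}^{\mathcal{L}}=M[[\mathcal{W}_{ij}(\mathcal{L});x]]$, $m_{ij}^{\lnot\mathcal{L}}=M[[\mathcal{W}_{ij}(\lnot\mathcal{L});x]]$. $\mathbf{1}_{l=i}$ is $1$ if $l=i$ and $0$ otherwise. *)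

theory Defs
  imports "HOL-Computational_Algebra.Formal_Power_Series"
begin

definition adjacency_matrix :: "nat \<Rightarrow> (nat \<Rightarrow> nat \<Rightarrow> nat) \<Rightarrow> bool" where
  "adjacency_matrix n g \<longleftrightarrow>
     (\<forall>i\<in>{1..n}. \<forall>j\<in>{1..n}. g i j \<in> {0, 1}) \<and> (\<forall>i\<in>{1..n}. g i i = 0)"

definition links :: "nat \<Rightarrow> (nat \<Rightarrow> nat \<Rightarrow> nat) \<Rightarrow> (nat \<times> nat) set" where
  "links n g = {(i, j). i \<in> {1..n} \<and> j \<in> {1..n} \<and> g i j = 1}"

text \<open>A walk $(i_0, \dots, i_K)$ is the nonempty list of its $K + 1$ nodes, so that
  \<open>w ! k\<close> is $i_k$.\<close>

definition walk_length :: "nat list \<Rightarrow> nat" where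
  "walk_length w = length w - 1"

definition walks :: "nat \<Rightarrow> (nat \<Rightarrow> nat \<Rightarrow> nat) \<Rightarrow> nat \<Rightarrow> nat \<Rightarrow> nat list set" where
  "walks n g i j = {w. w \<noteq> [] \<and> set w \<subseteq> {1..n} \<and>
     (\<forall>k\<in>{0..<walk_length w}. (w ! k, w ! (k + 1)) \<in> links n g) \<and>
     w ! 0 = i \<and> w ! walk_length w = j}"

text \<open>Only the interior positions $1, \dots, K - 1$ count for passing through a set of nodes;
  the two endpoints of the walk may lie in \<open>A\<close> or not.\<close>

definition walks_through_nodes ::
    "nat \<Rightarrow> (nat \<Rightarrow> nat \<Rightarrow> nat) \<Rightarrow> nat set \<Rightarrow> nat \<Rightarrow> nat \<Rightarrow> nat list set" where
  "walks_through_nodes n g A i j =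
     {w \<in> walks n g i j. \<exists>k\<in>{1..<walk_length w}. w ! k \<in> A}"

definition walks_avoiding_nodes ::
    "nat \<Rightarrow> (nat \<Rightarrow> nat \<Rightarrow> nat) \<Rightarrow> nat set \<Rightarrow> nat \<Rightarrow> nat \<Rightarrow> nat list set" where
  "walks_avoiding_nodes n g A i j =
     {w \<in> walks n g i j. \<forall>k\<in>{1..<walk_length w}. w ! k \<notin> A}"

definition walks_through_links ::
    "nat \<Rightarrow> (nat \<Rightarrow> nat \<Rightarrow> nat) \<Rightarrow> (nat \<times> nat) set \<Rightarrow> nat \<Rightarrow> nat \<Rightarrow> nat list set" where
  "walks_through_links n g L i j =
     {w \<in> walks n g i j. \<exists>k\<in>{0..<walk_length w}. (w ! k, w ! (k + 1)) \<in> L}"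

definition walks_avoiding_links ::
    "nat \<Rightarrow> (nat \<Rightarrow> nat \<Rightarrow> nat) \<Rightarrow> (nat \<times> nat) set \<Rightarrow> nat \<Rightarrow> nat \<Rightarrow> nat list set" where
  "walks_avoiding_links n g L i j =
     {w \<in> walks n g i j. \<forall>k\<in>{0..<walk_length w}. (w ! k, w ! (k + 1)) \<notin> L}"

text \<open>For the sets of walks above, every coefficient counts a finite set (node lists of fixed
  length over \<open>{1..n}\<close>), so the convention that \<open>card\<close> of an infinite set is 0 plays no role.
  Coefficients are integers because the decomposition through a node set subtracts 1.\<close>

definition gen_fun :: "nat list set \<Rightarrow> int fps" where
  "gen_fun W = Abs_fps (\<lambda>t. int (card {w \<in> W. walk_length w = t}))"

end

theory Submission
  imports Defs
begin

text \<open>Cut a walk at its first interior visit to \<open>A\<close>, respectively at its first traversal of a link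
  in \<open>L\<close>. The part before the cut avoids \<open>A\<close> (\<open>L\<close>), the part after it is arbitrary, and the cut is
  determined by the walk, so concatenation is a bijection; since lengths add up, generating functions
  multiply. In the node case both parts have positive length, whence the subtracted indicators,
  which remove the walk of length zero.\<close>

section \<open>Generating functions of sums and products\<close>

text \<open>Since \<open>card\<close> of an infinite set is 0, cardinalities of unions and products
  behave as expected only when each length occurs finitely often.\<close>

definition finite_levels :: "nat list set \<Rightarrow> bool" where
  "finite_levels W \<longleftrightarrow> (\<forall>t. finite {w \<in> W. walk_length w = t})"

lemma finite_levels_subset:
  assumes "finite_levels W" "W' \<subseteq> W"
  shows "finite_levels W'"
  unfolding finite_levels_def
proof
  fix t
  have "{w \<in> W'. walk_length w = t} \<subseteq> {w \<in> W. walk_length w = t}" using assms(2) by blast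
  then show "finite {w \<in> W'. walk_length w = t}"
    using assms(1) finite_subset unfolding finite_levels_def by blast
qed

lemma gen_fun_Un_disjoint:
  assumes "finite_levels U" "finite_levels V" "U \<inter> V = {}"
  shows "gen_fun (U \<union> V) = gen_fun U + gen_fun V"
proof (rule fps_ext)
  fix t
  have "{w \<in> U \<union> V. walk_length w = t}
      = {w \<in> U. walk_length w = t} \<union> {w \<in> V. walk_length w = t}" by blast
  moreover have "{w \<in> U. walk_length w = t} \<inter> {w \<in> V. walk_length w = t} = {}"
    using assms(3) by blast
  ultimately show "fps_nth (gen_fun (U \<union> V)) t = fps_nth (gen_fun U + gen_fun V) t"
    using assms(1,2) by (simp add: gen_fun_def finite_levels_def card_Un_disjoint)
qed

lemma gen_fun_singleton: "gen_fun {[x]} = 1"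
proof (rule fps_ext)
  fix t
  have "{w. w = [x] \<and> walk_length w = t} = (if t = 0 then {[x]} else {})"
    by (auto simp: walk_length_def)
  then show "fps_nth (gen_fun {[x]}) t = fps_nth 1 t" by (simp add: gen_fun_def)
qed

text \<open>Counting the triples \<open>(a, u, v)\<close> by total length gives, for each
  \<open>a\<close>, a Cauchy product shifted by \<open>d\<close>, the number of steps lying in
  neither piece. It serves with \<open>d = 0\<close> for pieces sharing a node and
  \<open>d = 1\<close> for pieces joined by a link.\<close>

lemma gen_fun_concatenation:
  assumes S: "finite S"
    and U: "\<And>a. a \<in> S \<Longrightarrow> finite_levels (U a)"
    and V: "\<And>a. a \<in> S \<Longrightarrow> finite_levels (V a)"
    and f: "bij_betw f (SIGMA a:S. U a \<times> V a) W"
    and len: "\<And>a u v. a \<in> S \<Longrightarrow> u \<in> U a \<Longrightarrow> v \<in> V a \<Longrightarrow>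
      walk_length (f (a, u, v)) = walk_length u + walk_length v + d"
  shows "gen_fun W = (\<Sum>a\<in>S. gen_fun (U a) * gen_fun (V a) * fps_X ^ d)"
proof (rule fps_ext)
  fix t
  let ?lev = "\<lambda>X s. {w \<in> X. walk_length w = s}"
  let ?P = "SIGMA a:S. {(u, v) \<in> U a \<times> V a. walk_length u + walk_length v + d = t}"
  have "?P \<subseteq> (SIGMA a:S. U a \<times> V a)" by auto
  then have "inj_on f ?P"
    by (rule inj_on_subset[OF bij_betw_imp_inj_on[OF f]])
  moreover have "?lev W t = f ` ?P"
    unfolding bij_betw_imp_surj_on[OF f, symmetric] using len by (auto simp: image_iff)
  ultimately have card: "card (?lev W t) = card ?P" by (simp add: card_image)
  have pairs: "finite {(u, v) \<in> U a \<times> V a. walk_length u + walk_length v + d = t} \<and>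
      int (card {(u, v) \<in> U a \<times> V a. walk_length u + walk_length v + d = t})
        = fps_nth (gen_fun (U a) * gen_fun (V a) * fps_X ^ d) t" if a: "a \<in> S" for a
  \<comment> \<open>Below \<open>d\<close> the truncated difference \<open>t - d\<close> would be
    misleading; there no pair exists and the coefficient is 0.\<close>
  proof (cases "t < d")
    case True
    then have "{(u, v) \<in> U a \<times> V a. walk_length u + walk_length v + d = t} = {}" by auto
    then show ?thesis using True by (simp add: fps_X_power_mult_right_nth)
  next
    case False
    have fin: "finite (?lev (U a) s)" "finite (?lev (V a) s)" for s
      using U[OF a] V[OF a] by (auto simp: finite_levels_def)
    \<comment> \<open>Sorting the pairs by the length \<open>s\<close> of the first piece gives
      disjoint rectangles, one for each summand of the Cauchy product at
      \<open>t - d\<close>.\<close>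
    have eq: "{(u, v) \<in> U a \<times> V a. walk_length u + walk_length v + d = t}
        = (\<Union>s\<in>{0..t - d}. ?lev (U a) s \<times> ?lev (V a) (t - d - s))"
      using False by auto
    have "card (\<Union>s\<in>{0..t - d}. ?lev (U a) s \<times> ?lev (V a) (t - d - s))
        = (\<Sum>s\<in>{0..t - d}. card (?lev (U a) s \<times> ?lev (V a) (t - d - s)))"
      using fin by (intro card_UN_disjoint) auto
    then have "int (card (\<Union>s\<in>{0..t - d}. ?lev (U a) s \<times> ?lev (V a) (t - d - s)))
        = fps_nth (gen_fun (U a) * gen_fun (V a)) (t - d)"
      by (simp add: fps_mult_nth gen_fun_def card_cartesian_product)
    moreover have "finite (\<Union>s\<in>{0..t - d}. ?lev (U a) s \<times> ?lev (V a) (t - d - s))"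
      using fin by (intro finite_UN_I finite_cartesian_product) auto
    ultimately show ?thesis
      using False unfolding eq by (simp only: fps_X_power_mult_right_nth if_False)
  qed
  have "fps_nth (gen_fun W) t = int (card ?P)" using card by (simp add: gen_fun_def)
  also have "\<dots> = (\<Sum>a\<in>S.
      int (card {(u, v) \<in> U a \<times> V a. walk_length u + walk_length v + d = t}))"
    using S pairs by (subst card_SigmaI) (blast, blast, simp only: of_nat_sum)
  also have "\<dots> = (\<Sum>a\<in>S. fps_nth (gen_fun (U a) * gen_fun (V a) * fps_X ^ d) t)"
    by (intro sum.cong refl conjunct2[OF pairs])
  finally show "fps_nth (gen_fun W) t
      = fps_nth (\<Sum>a\<in>S. gen_fun (U a) * gen_fun (V a) * fps_X ^ d) t"
    by (simp only: fps_sum_nth)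
qed

section \<open>Walks described by list operations\<close>

text \<open>Trades indices for \<open>successively\<close>, which splits along \<open>@\<close>, so
  that cutting and joining walks needs no index arithmetic.\<close>

lemma all_steps_iff_successively:
  "(\<forall>k\<in>{0..<walk_length w}. P (w ! k) (w ! (k + 1))) \<longleftrightarrow> successively P w"
  by (auto simp: successively_conv_nth walk_length_def less_diff_conv)

lemma walks_iff:
  "w \<in> walks n g i j \<longleftrightarrow> w \<noteq> [] \<and> set w \<subseteq> {1..n} \<and>
     successively (\<lambda>a b. (a, b) \<in> links n g) w \<and> hd w = i \<and> last w = j"
  unfolding walks_def
  using all_steps_iff_successively[of w "\<lambda>a b. (a, b) \<in> links n g"]
  by (auto simp: hd_conv_nth last_conv_nth walk_length_def)

lemma walks_avoiding_links_iff:
  "w \<in> walks_avoiding_links n g L i j \<longleftrightarrow>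
     w \<in> walks n g i j \<and> successively (\<lambda>a b. (a, b) \<notin> L) w"
  unfolding walks_avoiding_links_def
  using all_steps_iff_successively[of w "\<lambda>a b. (a, b) \<notin> L"] by simp

lemma set_interior: "set (butlast (tl w)) = (!) w ` {1..<walk_length w}"
proof -
  have "butlast (tl w) = map (\<lambda>k. w ! Suc k) [0..<walk_length w - 1]"
    by (rule nth_equalityI) (auto simp: nth_butlast nth_tl walk_length_def)
  then have "set (butlast (tl w)) = (!) w ` Suc ` {0..<walk_length w - 1}"
    by (simp only: set_map set_upt image_image)
  \<comment> \<open>For length 0 the subtraction truncates and both intervals are empty.\<close>
  also have "Suc ` {0..<walk_length w - 1} = {1..<walk_length w}"
    by (cases "walk_length w") (auto simp: image_Suc_atLeastLessThan)
  finally show ?thesis .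
qed

lemma walks_avoiding_nodes_iff:
  "w \<in> walks_avoiding_nodes n g A i j \<longleftrightarrow>
     w \<in> walks n g i j \<and> set (butlast (tl w)) \<inter> A = {}"
  unfolding walks_avoiding_nodes_def set_interior by blast

lemma walks_through_nodes_iff:
  "w \<in> walks_through_nodes n g A i j \<longleftrightarrow>
     w \<in> walks n g i j \<and> set (butlast (tl w)) \<inter> A \<noteq> {}"
  unfolding walks_through_nodes_def set_interior by blast

section \<open>Finiteness and splitting of the walk sets\<close>

lemma finite_levels_walks: "finite_levels (walks n g i j)"
  unfolding finite_levels_def
proof
  fix t
  have "{w \<in> walks n g i j. walk_length w = t} \<subseteq> {w. set w \<subseteq> {1..n} \<and> length w = Suc t}"
    by (auto simp: walks_def walk_length_def Suc_pred)
  then show "finite {w \<in> walks n g i j. walk_length w = t}"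
    by (rule finite_subset) (simp add: finite_lists_length_eq)
qed

lemma finite_levels_avoiding:
  "finite_levels (walks_avoiding_nodes n g A i j)"
  "finite_levels (walks_avoiding_links n g L i j)"
  by (rule finite_levels_subset[OF finite_levels_walks],
      auto simp: walks_avoiding_nodes_def walks_avoiding_links_def)+

lemma gen_fun_walks_split_nodes:
  "gen_fun (walks n g i j) =
     gen_fun (walks_avoiding_nodes n g A i j) + gen_fun (walks_through_nodes n g A i j)"
proof -
  have "walks n g i j = walks_avoiding_nodes n g A i j \<union> walks_through_nodes n g A i j"
    by (auto simp: walks_avoiding_nodes_def walks_through_nodes_def)
  moreover have "finite_levels (walks_through_nodes n g A i j)"
    by (rule finite_levels_subset[OF finite_levels_walks]) (auto simp: walks_through_nodes_def)
  ultimately show ?thesis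
    by (metis (no_types, lifting) finite_levels_avoiding(1) gen_fun_Un_disjoint disjoint_iff
        walks_avoiding_nodes_iff walks_through_nodes_iff)
qed

lemma gen_fun_walks_split_links:
  "gen_fun (walks n g i j) =
     gen_fun (walks_avoiding_links n g L i j) + gen_fun (walks_through_links n g L i j)"
proof -
  have "walks n g i j = walks_avoiding_links n g L i j \<union> walks_through_links n g L i j"
    "walks_avoiding_links n g L i j \<inter> walks_through_links n g L i j = {}"
    by (auto simp: walks_avoiding_links_def walks_through_links_def)
  moreover have "finite_levels (walks_through_links n g L i j)"
    by (rule finite_levels_subset[OF finite_levels_walks]) (auto simp: walks_through_links_def)
  ultimately show ?thesis
    by (metis finite_levels_avoiding(2) gen_fun_Un_disjoint)
qed

text \<open>The only possible member of length zero is \<open>[i]\<close>, which needs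
  \<open>i = j\<close> and has generating function 1. This is the source of the subtracted
  indicators.\<close>

lemma gen_fun_positive_length:
  assumes "finite_levels W" and W: "\<And>w. w \<in> W \<Longrightarrow> w \<noteq> [] \<and> hd w = i \<and> last w = j"
    and triv: "i = j \<Longrightarrow> [i] \<in> W"
  shows "gen_fun {w \<in> W. 0 < walk_length w} = gen_fun W - (if i = j then 1 else 0)"
proof -
  let ?T = "if i = j then {[i]} else {}"
  have "w \<in> ?T" if "w \<in> W" "walk_length w = 0" for w
    using W[OF that(1)] that(2) by (cases w) (auto simp: walk_length_def)
  then have "W = {w \<in> W. 0 < walk_length w} \<union> ?T"
    using triv by (cases "i = j") fastforce+
  moreover have "{w \<in> W. 0 < walk_length w} \<inter> ?T = {}"
    by (auto simp: walk_length_def)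
  moreover have "finite_levels {w \<in> W. 0 < walk_length w}"
    by (rule finite_levels_subset[OF assms(1)]) auto
  moreover have "finite_levels ?T" by (simp add: finite_levels_def)
  ultimately have "gen_fun W = gen_fun {w \<in> W. 0 < walk_length w} + gen_fun ?T"
    by (metis gen_fun_Un_disjoint)
  moreover have "gen_fun {} = 0" by (simp add: gen_fun_def fps_eq_iff)
  ultimately show ?thesis by (simp add: gen_fun_singleton)
qed

section \<open>First-occurrence cuts of lists and their uniqueness\<close>

text \<open>Applied with \<open>P\<close> saying that a step is not in \<open>L\<close>: then
  \<open>u\<close> is the part before the first link of \<open>L\<close>, and that link is
  \<open>(last u, hd v)\<close>.\<close>

lemma first_failing_step:
  assumes "\<not> successively P w"
  obtains u v where "w = u @ v" "u \<noteq> []" "v \<noteq> []" "successively P u" "\<not> P (last u) (hd v)"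
proof -
  have "\<exists>u v. w = u @ v \<and> u \<noteq> [] \<and> v \<noteq> [] \<and> successively P u \<and> \<not> P (last u) (hd v)"
    using assms
  proof (induction w rule: induct_list012)
    case (3 x y zs)
    show ?case
    proof (cases "P x y")
      case True
      then obtain u v where uv: "y # zs = u @ v" "u \<noteq> []" "v \<noteq> []"
        "successively P u" "\<not> P (last u) (hd v)"
        using 3 by auto
      \<comment> \<open>As \<open>u\<close> begins with \<open>y\<close>, prepending
        \<open>x\<close> adds only the step from \<open>x\<close> to \<open>y\<close>, which
        satisfies \<open>P\<close>.\<close>
      then have "hd u = y" by (metis hd_append2 list.sel(1))
      then show ?thesis
        using uv True by (intro exI[of _ "x # u"] exI[of _ v]) (auto simp: successively_Cons)
    next
      case False
      then show ?thesis by (intro exI[of _ "[x]"] exI[of _ "y # zs"]) simp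
    qed
  qed auto
  then show ?thesis using that by blast
qed

lemma first_failing_step_unique:
  assumes "u @ v = u' @ v'" "u \<noteq> []" "v \<noteq> []" "u' \<noteq> []" "v' \<noteq> []"
    and "successively P u" "successively P u'" "\<not> P (last u) (hd v)" "\<not> P (last u') (hd v')"
  shows "u = u'"
proof -
  \<comment> \<open>Of two prefixes one extends the other by some \<open>r\<close>. If
    \<open>r\<close> were nonempty, its head would be the head of \<open>c\<close>, so the failing
    step after \<open>a\<close> would lie inside \<open>b\<close>, where all steps satisfy
    \<open>P\<close>.\<close>
  have *: "r = []" if "b = a @ r" "r @ d = c" "a \<noteq> []" "successively P b" "\<not> P (last a) (hd c)"
    for a b c d r
    using that by (cases r) (auto simp: successively_append_iff)
  show ?thesis
    using assms * unfolding append_eq_append_conv2 by (metis append_Nil2)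
qed

text \<open>The prefix is recovered from the list as its longest initial segment outside
  \<open>A\<close>.\<close>

lemma first_member_unique:
  assumes "ys @ x # zs = ys' @ x' # zs'"
    and "set ys \<inter> A = {}" "set ys' \<inter> A = {}" "x \<in> A" "x' \<in> A"
  shows "ys = ys' \<and> x = x' \<and> zs = zs'"
proof -
  have "takeWhile (\<lambda>y. y \<notin> A) (as @ a # bs) = as" if "set as \<inter> A = {}" "a \<in> A" for as a bs
    using that by (auto simp: takeWhile_append disjoint_iff)
  then have "ys = ys'" using assms by metis
  then show ?thesis using assms(1) by simp
qed

text \<open>Positive length makes the first and last positions distinct, even when
  \<open>i = j\<close>, so both ends can be split off.\<close>

lemma positive_length_walk_shape:
  assumes "w \<in> walks n g i j" "0 < walk_length w"
  shows "w = i # butlast (tl w) @ [j]"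
  using assms by (cases w) (auto simp: walks_iff walk_length_def)

section \<open>Bijections between walks and their pieces\<close>

text \<open>Both pieces contain the cut node \<open>l\<close>, and \<open>butlast\<close> removes
  the duplicate. Their positive lengths make \<open>l\<close> an interior node of the joined
  walk.\<close>

lemma bij_betw_first_node:
  "bij_betw (\<lambda>(l, u, v). butlast u @ v)
     (SIGMA l:A. {u \<in> walks_avoiding_nodes n g A i l. 0 < walk_length u} \<times>
        {v \<in> walks n g l j. 0 < walk_length v})
     (walks_through_nodes n g A i j)"
  (is "bij_betw ?f ?D ?W")
proof (rule bij_betw_imageI)
  \<comment> \<open>With \<open>p\<close> and \<open>q\<close> exposed, the joined walk reads
    \<open>i # p @ l # q @ [j]\<close>, with \<open>l\<close> its first interior node in
    \<open>A\<close>.\<close>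
  have shape: "\<exists>p q. u = i # p @ [l] \<and> v = l # q @ [j] \<and> set p \<inter> A = {} \<and> l \<in> A"
    if "(l, u, v) \<in> ?D" for l u v
    using that positive_length_walk_shape[of u n g i l] positive_length_walk_shape[of v n g l j]
    by (auto simp: walks_avoiding_nodes_iff)
  show "inj_on ?f ?D"
  proof (rule inj_onI)
    fix a b assume D: "a \<in> ?D" "b \<in> ?D" and eq: "?f a = ?f b"
    obtain l u v l' u' v' where ab: "a = (l, u, v)" "b = (l', u', v')"
      by (metis prod.collapse)
    obtain p q where 1: "u = i # p @ [l]" "v = l # q @ [j]" "set p \<inter> A = {}" "l \<in> A"
      using shape D(1) ab by blast
    obtain p' q' where 2: "u' = i # p' @ [l']" "v' = l' # q' @ [j]" "set p' \<inter> A = {}" "l' \<in> A"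
      using shape D(2) ab by blast
    have "p @ l # q @ [j] = p' @ l' # q' @ [j]"
      using eq by (simp add: ab 1 2 butlast_append)
    from first_member_unique[OF this 1(3) 2(3) 1(4) 2(4)] show "a = b"
      by (simp add: ab 1 2)
  qed
  show "?f ` ?D = ?W"
  proof (intro equalityI subsetI)
    fix w assume "w \<in> ?f ` ?D"
    then obtain l u v where D: "(l, u, v) \<in> ?D" and w: "w = butlast u @ v" by auto
    obtain p q where s: "u = i # p @ [l]" "v = l # q @ [j]" "l \<in> A"
      using shape[OF D] by blast
    show "w \<in> ?W"
      using D unfolding w s
      by (auto simp: hd_append s(3) walks_through_nodes_iff walks_avoiding_nodes_iff walks_iff butlast_append
          successively_append_iff successively_Cons)
  next
    fix w assume w: "w \<in> ?W"
    then have W: "w \<in> walks n g i j" and "\<exists>x\<in>set (butlast (tl w)). x \<in> A"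
      by (auto simp: walks_through_nodes_iff)
    \<comment> \<open>The cut is made at the first interior node in \<open>A\<close>, so that
      \<open>i # p @ [l]\<close> has no interior node in \<open>A\<close>.\<close>
    then obtain p l q where pq: "butlast (tl w) = p @ l # q" "l \<in> A" "\<forall>y\<in>set p. y \<notin> A"
      by (elim split_list_first_propE)
    then have "0 < walk_length w" by (cases w) (auto simp: walk_length_def)
    then have s: "w = i # p @ l # q @ [j]"
      using positive_length_walk_shape[OF W] pq(1) by simp
    have "(l, i # p @ [l], l # q @ [j]) \<in> ?D"
      using W pq(2,3) unfolding s
      by (auto simp: hd_append walks_avoiding_nodes_iff walks_iff walk_length_def butlast_append
          successively_append_iff successively_Cons)
    moreover have "w = ?f (l, i # p @ [l], l # q @ [j])" by (simp add: s butlast_append)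
    ultimately show "w \<in> ?f ` ?D" by blast
  qed
qed

text \<open>The pieces share no position: the link \<open>e\<close> bridges the end of
  \<open>u\<close> and the start of \<open>v\<close>. As \<open>L\<close> consists of links, the
  joined list is again a walk.\<close>

lemma bij_betw_first_link:
  assumes "L \<subseteq> links n g"
  shows "bij_betw (\<lambda>(e, u, v). u @ v)
     (SIGMA e:L. walks_avoiding_links n g L i (fst e) \<times> walks n g (snd e) j)
     (walks_through_links n g L i j)"
  (is "bij_betw ?f ?D ?W")
proof (rule bij_betw_imageI)
  let ?P = "\<lambda>a b. (a, b) \<notin> L"
  have through: "w \<in> ?W \<longleftrightarrow> w \<in> walks n g i j \<and> \<not> successively ?P w" for w
    unfolding walks_through_links_def
    using all_steps_iff_successively[of w ?P] by auto
  \<comment> \<open>The domain becomes the set of cuts of walks at their first link in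
    \<open>L\<close>; in particular \<open>e\<close> is determined by \<open>u\<close> and
    \<open>v\<close>.\<close>
  have D: "(e, u, v) \<in> ?D \<longleftrightarrow> e \<in> L \<and> u \<noteq> [] \<and> v \<noteq> [] \<and> e = (last u, hd v) \<and>
      successively ?P u \<and> u @ v \<in> walks n g i j" for e u v
    using assms by (cases e) (auto simp: walks_avoiding_links_iff walks_iff successively_append_iff)
  show "inj_on ?f ?D"
  proof (rule inj_onI)
    fix a b assume ab: "a \<in> ?D" "b \<in> ?D" and eq: "?f a = ?f b"
    obtain e u v e' u' v' where s: "a = (e, u, v)" "b = (e', u', v')"
      by (metis prod.collapse)
    have "u = u'"
      by (rule first_failing_step_unique[of u v u' v' ?P]) (use ab eq s D in auto)
    moreover from this have "v = v'" using eq s by simp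
    ultimately show "a = b" using ab unfolding s D by simp
  qed
  show "?f ` ?D = ?W"
  proof (intro equalityI subsetI)
    fix w assume "w \<in> ?f ` ?D"
    then obtain e u v where "(e, u, v) \<in> ?D" "w = u @ v" by auto
    then show "w \<in> ?W" unfolding D through by (auto simp: successively_append_iff)
  next
    fix w assume "w \<in> ?W"
    then have W: "w \<in> walks n g i j" and "\<not> successively ?P w" by (auto simp: through)
    then obtain u v where uv: "w = u @ v" "u \<noteq> []" "v \<noteq> []" "successively ?P u"
      "(last u, hd v) \<in> L"
      by (elim first_failing_step) auto
    then have "((last u, hd v), u, v) \<in> ?D" using W unfolding D by auto
    then show "w \<in> ?f ` ?D" using uv(1) by force
  qed
qed

section \<open>The product formulas\<close>

lemma gen_fun_walks_through_nodes:
  assumes "A \<subseteq> {1..n}" "i \<in> {1..n}"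
  shows "gen_fun (walks_through_nodes n g A i j) =
    (\<Sum>l\<in>A. (gen_fun (walks_avoiding_nodes n g A i l) - (if l = i then 1 else 0)) *
      (gen_fun (walks n g l j) - (if l = j then 1 else 0)))"
proof -
  let ?U = "\<lambda>l. {u \<in> walks_avoiding_nodes n g A i l. 0 < walk_length u}"
  let ?V = "\<lambda>l. {v \<in> walks n g l j. 0 < walk_length v}"
  \<comment> \<open>The exponent is 0 because every step of the joined walk belongs to exactly one
    piece.\<close>
  have "gen_fun (walks_through_nodes n g A i j)
      = (\<Sum>l\<in>A. gen_fun (?U l) * gen_fun (?V l) * fps_X ^ 0)"
  proof (rule gen_fun_concatenation[OF _ _ _ bij_betw_first_node])
    show "finite A" using assms(1) finite_subset by blast
    show "finite_levels (?U l)" for l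
      by (rule finite_levels_subset[OF finite_levels_avoiding(1)]) auto
    show "finite_levels (?V l)" for l
      by (rule finite_levels_subset[OF finite_levels_walks]) auto
  qed (auto simp: walk_length_def)
  also have "\<dots> = (\<Sum>l\<in>A. (gen_fun (walks_avoiding_nodes n g A i l) - (if l = i then 1 else 0)) *
      (gen_fun (walks n g l j) - (if l = j then 1 else 0)))"
  proof (rule sum.cong[OF refl])
    fix l assume "l \<in> A"
    then have l: "l \<in> {1..n}" using assms(1) by blast
    \<comment> \<open>For \<open>l = i\<close> the removed walk is \<open>[i]\<close>: it is a walk
      since \<open>i\<close> is a node, and it avoids \<open>A\<close> for want of an
      interior.\<close>
    have "gen_fun (?U l) = gen_fun (walks_avoiding_nodes n g A i l) - (if i = l then 1 else 0)"
      by (rule gen_fun_positive_length[OF finite_levels_avoiding(1)])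
        (use assms(2) in \<open>auto simp: walks_avoiding_nodes_iff walks_iff\<close>)
    moreover have "gen_fun (?V l) = gen_fun (walks n g l j) - (if l = j then 1 else 0)"
      by (rule gen_fun_positive_length[OF finite_levels_walks])
        (use l in \<open>auto simp: walks_iff\<close>)
    ultimately show "gen_fun (?U l) * gen_fun (?V l) * fps_X ^ 0 =
        (gen_fun (walks_avoiding_nodes n g A i l) - (if l = i then 1 else 0)) *
        (gen_fun (walks n g l j) - (if l = j then 1 else 0))"
      by (simp add: eq_commute[of i l])
  qed
  finally show ?thesis .
qed

lemma gen_fun_walks_through_links:
  assumes "L \<subseteq> links n g"
  shows "gen_fun (walks_through_links n g L i j) =
    (\<Sum>(l, k)\<in>L. gen_fun (walks_avoiding_links n g L i l) * gen_fun (walks n g k j) * fps_X)"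
proof -
  have "links n g \<subseteq> {1..n} \<times> {1..n}" by (auto simp: links_def)
  then have "finite L" using assms by (meson finite_SigmaI finite_atLeastAtMost finite_subset)
  \<comment> \<open>The exponent 1 counts the step along the cut link, which belongs to neither
    piece.\<close>
  then have "gen_fun (walks_through_links n g L i j) =
    (\<Sum>e\<in>L. gen_fun (walks_avoiding_links n g L i (fst e)) * gen_fun (walks n g (snd e) j) * fps_X ^ 1)"
    by (rule gen_fun_concatenation[OF _ _ _ bij_betw_first_link[OF assms]])
      (auto simp: finite_levels_avoiding finite_levels_walks walk_length_def walks_iff
        walks_avoiding_links_iff neq_Nil_conv)
  then show ?thesis by (simp add: case_prod_beta)
qed

theorem theorem1:
  fixes n :: nat and g :: "nat \<Rightarrow> nat \<Rightarrow> nat" and i j :: nat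
  assumes "adjacency_matrix n g"
    and "i \<in> {1..n}" and "j \<in> {1..n}"
  shows "(\<forall>A. A \<subseteq> {1..n} \<longrightarrow>
            gen_fun (walks n g i j) =
              gen_fun (walks_avoiding_nodes n g A i j) + gen_fun (walks_through_nodes n g A i j) \<and>
            gen_fun (walks_through_nodes n g A i j) =
              (\<Sum>l\<in>A. (gen_fun (walks_avoiding_nodes n g A i l) - (if l = i then 1 else 0)) *
                     (gen_fun (walks n g l j) - (if l = j then 1 else 0)))) \<and>
         (\<forall>L. L \<subseteq> links n g \<longrightarrow>
            gen_fun (walks n g i j) =
              gen_fun (walks_avoiding_links n g L i j) + gen_fun (walks_through_links n g L i j) \<and>
            gen_fun (walks_through_links n g L i j) =
              (\<Sum>(l, k)\<in>L. gen_fun (walks_avoiding_links n g L i l) * gen_fun (walks n g k j) * fps_X))"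
  by (intro conjI allI impI gen_fun_walks_split_nodes gen_fun_walks_split_links
      gen_fun_walks_through_nodes gen_fun_walks_through_links assms(2))

end
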